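(* There is an infinite family of graphs $G$ whose stretch-width $\mathrm{stw}(G)$ is bounded by a constant and whose clique-width is in $\Omega(\log |V(G)|/\log\log|V(G)|)$.
   Context: All graphs are finite and simple. A partition sequence of an $n$-vertex graph $G$ is a sequence $\mathcal P_n,\dots,\mathcal P_1$ of partitions of $V(G)$ such that $\mathcal P_n$ is the partition into singletons, $\mathcal P_1=\{V(G)\}$, and each $\mathcal P_i$ ($i<n$) is obtained from $\mathcal P_{i+1}$ by merging two parts. Two distinct parts $X,Y$ are inhomogeneous if there are $u,u'\in X$, $v,v'\in Y$ with $uv\in E(G)$, $u'v'\notin E(G)$. The red graph $\mathcal R(\mathcal P)$ has vertex set $\mathcal P$ and edges between inhomogeneous parts. For a total order $\prec$ on $V(G)$ and $X\subseteq V(G)$, the span $\langle X\rangle=\{v:\min X\preceq v\preceq\max X\}$; $X,Y$ conflict if their spans intersect. For $X\in\mathcal P$, a part $Y\in\mathcal P\setminus\{X\}$ interferes with $X$ if $Y$ conflicts with the union of the parts in the closed neighborhood of $X$ in $\mathcal R(\mathcal P)$; the stretch of $X$ is the number of parts interfering with $X$; the stretch of $\mathcal P$ is the maximum stretch of a part. $\mathrm{stw}(G,\prec)$ is the minimum over partition sequences of the maximum stretch of its partitions, and $\mathrm{stw}(G)=\min_\prec \mathrm{stw}(G,\prec)$. *)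

theory Defs
  imports
    Complex_Main
    "HOL-Library.Disjoint_Sets"
    "HOL-Library.Landau_Symbols"
    "Graph_Theory.Pair_Digraph"
begin

text \<open>
  A finite simple undirected graph is a \<open>pair_graph\<close>: a finite, loop-free digraph without parallel
  arcs whose arc relation is symmetric. An edge \<open>uv\<close> is the pair of arcs \<open>(u, v)\<close>, \<open>(v, u)\<close>.
\<close>

abbreviation graph_order :: "'a pair_pre_digraph \<Rightarrow> nat" where
  "graph_order G \<equiv> card (pverts G)"


section \<open>Stretch-width\<close>

definition merges_two_parts :: "'a set set \<Rightarrow> 'a set set \<Rightarrow> bool" where
  "merges_two_parts P Q \<longleftrightarrow>
     (\<exists>X\<in>P. \<exists>Y\<in>P. X \<noteq> Y \<and> Q = insert (X \<union> Y) (P - {X, Y}))"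

text \<open>The values of \<open>P\<close> outside \<open>{1..graph_order G}\<close> are irrelevant.\<close>

definition partition_sequence :: "'a pair_pre_digraph \<Rightarrow> (nat \<Rightarrow> 'a set set) \<Rightarrow> bool" where
  "partition_sequence G P \<longleftrightarrow>
     (\<forall>i\<in>{1..graph_order G}. partition_on (pverts G) (P i)) \<and>
     P (graph_order G) = {{v} |v. v \<in> pverts G} \<and>
     P 1 = {pverts G} \<and>
     (\<forall>i\<in>{1..<graph_order G}. merges_two_parts (P (Suc i)) (P i))"

definition inhomogeneous :: "'a pair_pre_digraph \<Rightarrow> 'a set \<Rightarrow> 'a set \<Rightarrow> bool" where
  "inhomogeneous G X Y \<longleftrightarrow> X \<noteq> Y \<and>
     (\<exists>u\<in>X. \<exists>v\<in>Y. (u, v) \<in> parcs G) \<and> (\<exists>u'\<in>X. \<exists>v'\<in>Y. (u', v') \<notin> parcs G)"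

definition red_graph :: "'a pair_pre_digraph \<Rightarrow> 'a set set \<Rightarrow> 'a set pair_pre_digraph" where
  "red_graph G P =
     \<lparr>pverts = P, parcs = {(X, Y). X \<in> P \<and> Y \<in> P \<and> inhomogeneous G X Y}\<rparr>"

definition closed_neighborhood :: "'a pair_pre_digraph \<Rightarrow> 'a \<Rightarrow> 'a set" where
  "closed_neighborhood G x = insert x {y. (x, y) \<in> parcs G}"

text \<open>
  A total order on the vertex set is a reflexive relation \<open>r\<close> with \<open>linear_order_on (pverts G) r\<close>;
  \<open>(u, v) \<in> r\<close> means that \<open>u\<close> is below or equal to \<open>v\<close>. Minimum and maximum are only meaningful
  for finite nonempty subsets of the vertex set.
\<close>

definition min_wrt :: "'a rel \<Rightarrow> 'a set \<Rightarrow> 'a" where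
  "min_wrt r X = (THE x. x \<in> X \<and> (\<forall>y\<in>X. (x, y) \<in> r))"

definition max_wrt :: "'a rel \<Rightarrow> 'a set \<Rightarrow> 'a" where
  "max_wrt r X = (THE x. x \<in> X \<and> (\<forall>y\<in>X. (y, x) \<in> r))"

definition span_wrt :: "'a rel \<Rightarrow> 'a set \<Rightarrow> 'a set" where
  "span_wrt r X = {v. (min_wrt r X, v) \<in> r \<and> (v, max_wrt r X) \<in> r}"

definition in_conflict :: "'a rel \<Rightarrow> 'a set \<Rightarrow> 'a set \<Rightarrow> bool" where
  "in_conflict r X Y \<longleftrightarrow> span_wrt r X \<inter> span_wrt r Y \<noteq> {}"

definition interferes ::
    "'a pair_pre_digraph \<Rightarrow> 'a rel \<Rightarrow> 'a set set \<Rightarrow> 'a set \<Rightarrow> 'a set \<Rightarrow> bool" where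
  "interferes G r P Y X \<longleftrightarrow>
     Y \<in> P - {X} \<and> in_conflict r Y (\<Union>(closed_neighborhood (red_graph G P) X))"

definition part_stretch ::
    "'a pair_pre_digraph \<Rightarrow> 'a rel \<Rightarrow> 'a set set \<Rightarrow> 'a set \<Rightarrow> nat" where
  "part_stretch G r P X = card {Y. interferes G r P Y X}"

definition partition_stretch :: "'a pair_pre_digraph \<Rightarrow> 'a rel \<Rightarrow> 'a set set \<Rightarrow> nat" where
  "partition_stretch G r P = Max (part_stretch G r P ` P)"

text \<open>
  On sets of natural numbers \<open>Inf\<close> is the minimum as soon as the set is nonempty. The two sets
  below are nonempty by \<open>partition_sequence_exists\<close> and \<open>linear_order_exists\<close>.
\<close>

definition stretch_width_wrt :: "'a pair_pre_digraph \<Rightarrow> 'a rel \<Rightarrow> nat" where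
  "stretch_width_wrt G r =
     Inf {Max ((\<lambda>i. partition_stretch G r (P i)) ` {1..graph_order G}) |P. partition_sequence G P}"

definition stretch_width :: "'a pair_pre_digraph \<Rightarrow> nat" where
  "stretch_width G = Inf {stretch_width_wrt G r |r. linear_order_on (pverts G) r}"

lemma partition_sequence_exists:
  assumes fin: "finite (pverts G)" and ne: "pverts G \<noteq> {}"
  shows "\<exists>P. partition_sequence G P"
proof -
  define n where "n = graph_order G"
  obtain f where f: "bij_betw f {1..n} (pverts G)"
    using ex_bij_betw_nat_finite_1[OF fin] n_def by blast
  have inj: "inj_on f {1..n}" and img: "f ` {1..n} = pverts G"
    using f by (auto simp: bij_betw_def)
  have n: "n \<ge> 1"
    using fin ne by (simp add: n_def Suc_le_eq card_gt_0_iff)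
  define P where "P i = insert (f ` {i..n}) ((\<lambda>j. {f j}) ` {1..<i})" for i
  have f_eq: "f i = f j \<longleftrightarrow> i = j" if "i \<in> {1..n}" "j \<in> {1..n}" for i j
    using inj that by (auto dest: inj_onD)
  have part: "partition_on (pverts G) (P i)" if i: "i \<in> {1..n}" for i
  proof (rule partition_onI)
    have "\<Union>(P i) = f ` ({i..n} \<union> {1..<i})"
      by (auto simp: P_def)
    also have "{i..n} \<union> {1..<i} = {1..n}"
      using i by auto
    finally show "\<Union>(P i) = pverts G"
      using img by simp
    show "{} \<notin> P i"
      using i by (auto simp: P_def)
    show "disjnt p q" if "p \<in> P i" "q \<in> P i" "p \<noteq> q" for p q
      using that i by (auto simp: P_def disjnt_def f_eq)
  qed
  have sing: "P n = {{v} |v. v \<in> pverts G}"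
  proof -
    have "P n = (\<lambda>j. {f j}) ` insert n {1..<n}"
      by (simp add: P_def)
    also have "insert n {1..<n} = {1..n}"
      using n by auto
    finally show ?thesis
      using img by (auto simp: image_iff)
  qed
  have top: "P 1 = {pverts G}"
    using img by (simp add: P_def)
  have merge: "merges_two_parts (P (Suc i)) (P i)" if i: "i \<in> {1..<n}" for i
  proof -
    have ne: "{f i} \<noteq> f ` {Suc i..n}"
    proof
      assume "{f i} = f ` {Suc i..n}"
      then have "f i \<in> f ` {Suc i..n}" by blast
      then show False using i by (auto simp: f_eq)
    qed
    have un: "f ` {i..n} = {f i} \<union> f ` {Suc i..n}"
    proof -
      have "{i..n} = insert i {Suc i..n}" using i by auto
      then show ?thesis by simp
    qed
    have S: "(\<lambda>j. {f j}) ` {1..<Suc i} = insert {f i} ((\<lambda>j. {f j}) ` {1..<i})"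
    proof -
      have "{1..<Suc i} = insert i {1..<i}" using i by auto
      then show ?thesis by simp
    qed
    have n1: "{f i} \<notin> (\<lambda>j. {f j}) ` {1..<i}"
      using i by (auto simp: f_eq)
    have n2: "f ` {Suc i..n} \<notin> (\<lambda>j. {f j}) ` {1..<i}"
    proof
      assume "f ` {Suc i..n} \<in> (\<lambda>j. {f j}) ` {1..<i}"
      then obtain j where j: "j \<in> {1..<i}" and e: "f ` {Suc i..n} = {f j}" by auto
      have "f n \<in> f ` {Suc i..n}" using i by auto
      then have "f n = f j" using e by simp
      then show False using i j by (auto simp: f_eq)
    qed
    have "P i = insert ({f i} \<union> f ` {Suc i..n}) (P (Suc i) - {{f i}, f ` {Suc i..n}})"
      unfolding P_def S un using n1 n2 by blast
    moreover have "{f i} \<in> P (Suc i)" "f ` {Suc i..n} \<in> P (Suc i)"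
      unfolding P_def S by simp_all
    ultimately show ?thesis
      unfolding merges_two_parts_def using ne by (intro bexI conjI)
  qed
  show ?thesis
    unfolding partition_sequence_def n_def[symmetric]
    by (intro exI[of _ P] conjI ballI part merge sing top)
qed

lemma linear_order_exists: "\<exists>r. linear_order_on (pverts G) r"
  using well_order_on[of "pverts G"] unfolding well_order_on_def by blast


section \<open>Clique-width\<close>

text \<open>
  \<open>clique_expr k G l\<close>: the graph \<open>G\<close> with vertex labelling \<open>l\<close> is the value of an expression over
  the labels \<open>1, \<dots>, k\<close> built from the operations "new vertex with label \<open>i\<close>", "disjoint union",
  "add all edges between label \<open>i\<close> and label \<open>j\<close>" (for distinct \<open>i\<close> and \<open>j\<close>), and "relabel \<open>i\<close> to
  \<open>j\<close>". Vertex names are chosen freely in the first operation, so the class of constructible graphs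
  is closed under renaming of vertices. Labels of non-vertices carry no information.
\<close>

inductive clique_expr :: "nat \<Rightarrow> 'a pair_pre_digraph \<Rightarrow> ('a \<Rightarrow> nat) \<Rightarrow> bool" for k :: nat where
  vertex: "i \<in> {1..k} \<Longrightarrow> clique_expr k \<lparr>pverts = {v}, parcs = {}\<rparr> (\<lambda>_. i)"
| disjoint_union: "clique_expr k G l \<Longrightarrow> clique_expr k H m \<Longrightarrow> pverts G \<inter> pverts H = {} \<Longrightarrow>
    clique_expr k \<lparr>pverts = pverts G \<union> pverts H, parcs = parcs G \<union> parcs H\<rparr>
      (\<lambda>v. if v \<in> pverts G then l v else m v)"
| join: "clique_expr k G l \<Longrightarrow> i \<in> {1..k} \<Longrightarrow> j \<in> {1..k} \<Longrightarrow> i \<noteq> j \<Longrightarrow>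
    clique_expr k
      \<lparr>pverts = pverts G,
       parcs = parcs G \<union> {(u, v). u \<in> pverts G \<and> v \<in> pverts G \<and>
                                 (l u = i \<and> l v = j \<or> l u = j \<and> l v = i)}\<rparr>
      l"
| relabel: "clique_expr k G l \<Longrightarrow> i \<in> {1..k} \<Longrightarrow> j \<in> {1..k} \<Longrightarrow>
    clique_expr k G (\<lambda>v. if l v = i then j else l v)"

definition clique_width :: "'a pair_pre_digraph \<Rightarrow> nat" where
  "clique_width G = (LEAST k. \<exists>l. clique_expr k G l)"

lemma clique_expr_edgeless:
  assumes "finite V" "V \<noteq> {}" "\<And>v. v \<in> V \<Longrightarrow> l v \<in> {1..k}"
  shows "\<exists>l'. clique_expr k \<lparr>pverts = V, parcs = {}\<rparr> l' \<and> (\<forall>v\<in>V. l' v = l v)"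
  using assms
proof (induction V rule: finite_ne_induct)
  case (singleton v)
  then have "clique_expr k \<lparr>pverts = {v}, parcs = {}\<rparr> (\<lambda>_. l v)"
    by (intro clique_expr.vertex) simp
  then show ?case by auto
next
  case (insert v V)
  then obtain l' where l': "clique_expr k \<lparr>pverts = V, parcs = {}\<rparr> l'" "\<forall>v\<in>V. l' v = l v"
    by auto
  have "clique_expr k \<lparr>pverts = {v}, parcs = {}\<rparr> (\<lambda>_. l v)"
    using insert.prems by (intro clique_expr.vertex) simp
  from clique_expr.disjoint_union[OF this l'(1)] insert.hyps
  have "clique_expr k \<lparr>pverts = insert v V, parcs = {}\<rparr> (\<lambda>x. if x = v then l v else l' x)"
    by (simp cong: if_cong)
  then show ?case
    using l'(2) insert.hyps by (intro exI conjI) auto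
qed

lemma clique_expr_exists:
  assumes "pair_graph G" and "pverts G \<noteq> {}"
  shows "\<exists>l. clique_expr (graph_order G) G l"
proof -
  interpret pair_graph G by fact
  let ?k = "graph_order G" and ?V = "pverts G"
  obtain f where f: "bij_betw f ?V {1..?k}"
    using finite_same_card_bij[of ?V "{1..?k}"] pair_finite_verts by auto
  obtain l where l: "clique_expr ?k \<lparr>pverts = ?V, parcs = {}\<rparr> l" and lf: "\<forall>v\<in>?V. l v = f v"
    using clique_expr_edgeless[OF pair_finite_verts assms(2), of f ?k] bij_betwE[OF f] by blast
  have l_eq: "l u = l v \<longleftrightarrow> u = v" if "u \<in> ?V" "v \<in> ?V" for u v
    using that f lf by (auto simp: bij_betw_def dest: inj_onD)
  have l_in: "l v \<in> {1..?k}" if "v \<in> ?V" for v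
    using that f lf by (auto simp: bij_betw_def)
  have "clique_expr ?k \<lparr>pverts = ?V, parcs = S \<union> S\<inverse>\<rparr> l"
    if "finite S" "S \<subseteq> parcs G" for S
    using that
  proof (induction S rule: finite_induct)
    case empty
    then show ?case using l by simp
  next
    case (insert e S)
    obtain a b where e: "e = (a, b)" by (cases e)
    have ab: "a \<in> ?V" "b \<in> ?V" "a \<noteq> b"
      using insert.prems pair_no_loops[of e] e by (auto dest: in_arcsD1 in_arcsD2)
    have "{(u, v). u \<in> ?V \<and> v \<in> ?V \<and> (l u = l a \<and> l v = l b \<or> l u = l b \<and> l v = l a)}
        = {(a, b), (b, a)}"
      using ab by (auto simp: l_eq)
    moreover have "clique_expr ?k \<lparr>pverts = ?V, parcs = S \<union> S\<inverse>\<rparr> l"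
      using insert by auto
    note clique_expr.join[OF this l_in[OF ab(1)] l_in[OF ab(2)]]
    ultimately have "clique_expr ?k \<lparr>pverts = ?V, parcs = (S \<union> S\<inverse>) \<union> {(a, b), (b, a)}\<rparr> l"
      using ab by (simp add: l_eq)
    moreover have "insert e S \<union> (insert e S)\<inverse> = (S \<union> S\<inverse>) \<union> {(a, b), (b, a)}"
      using e by auto
    ultimately show ?case by simp
  qed
  from this[OF pair_finite_arcs order_refl]
  have "clique_expr ?k \<lparr>pverts = ?V, parcs = parcs G \<union> (parcs G)\<inverse>\<rparr> l" .
  moreover have "parcs G \<union> (parcs G)\<inverse> = parcs G"
    using pair_sym_arcs by (auto simp: symmetric_def dest: symD)
  moreover have "\<lparr>pverts = ?V, parcs = parcs G\<rparr> = G"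
    by (cases G) simp
  ultimately have "clique_expr ?k G l" by simp
  from exI[of "clique_expr ?k G", OF this] show ?thesis .
qed

end

theory Submission
  imports Defs
begin

text \<open>
  The graphs are complete binary trees with a path added along each level (only the edges to left
  children are kept), ordered by in-order traversal, so that a vertex is a positive integer and its
  height is the exponent of 2 in it. Contracting the subtrees level by level keeps all parts
  intervals. When the subtrees below height \<open>t\<close> are contracted, a red edge joins parts at distance
  \<open>O(2 ^ t)\<close>, and only boundedly many parts meet an interval of that length. Hence the stretch-width
  is bounded.

  On the other hand, with \<open>m * 2 ^ m\<close> vertices the bottom \<open>m\<close> levels contain a subdivided \<open>m\<close> by \<open>m\<close>
  grid. An expression with \<open>k\<close> labels has a subexpression whose vertex set \<open>X\<close> contains between one
  and two thirds of the grid points. Either every row or at least a third of the columns contains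
  an edge leaving \<open>X\<close>, whereas vertices of \<open>X\<close> with equal labels have the same neighbours outside
  \<open>X\<close>. As degrees are at most 4, there are at most \<open>4 * k\<close> such disjoint paths, so \<open>k\<close> is linear
  in \<open>m\<close>.
\<close>

section \<open>Balanced subexpressions\<close>

lemma clique_expr_wf:
  assumes "clique_expr k G l"
  shows "finite (pverts G)" "parcs G \<subseteq> pverts G \<times> pverts G" "\<forall>v\<in>pverts G. l v \<in> {1..k}"
  using assms by (induction) auto

definition twins_outside :: "'a pair_pre_digraph \<Rightarrow> 'a set \<Rightarrow> 'a \<Rightarrow> 'a \<Rightarrow> bool" where
  "twins_outside G X u u' \<longleftrightarrow> (\<forall>v\<in>pverts G - X. (u, v) \<in> parcs G \<longleftrightarrow> (u', v) \<in> parcs G)"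

text \<open>The arcs leaving \<open>u\<close> and \<open>u'\<close> in \<open>K\<close> end inside
  \<open>G\<close>, so a vertex of \<open>K\<close> outside \<open>G\<close> is adjacent to
  neither.\<close>

lemma twins_outside_superset:
  assumes "twins_outside G X u u'"
    and "pverts G \<subseteq> pverts K"
    and "\<And>v. (u, v) \<in> parcs K \<longleftrightarrow> (u, v) \<in> parcs G" "\<And>v. (u', v) \<in> parcs K \<longleftrightarrow> (u', v) \<in> parcs G"
    and "parcs G \<subseteq> pverts G \<times> pverts G"
  shows "twins_outside K X u u'"
  unfolding twins_outside_def
proof
  fix v assume "v \<in> pverts K - X"
  then show "(u, v) \<in> parcs K \<longleftrightarrow> (u', v) \<in> parcs K"
    using assms by (cases "v \<in> pverts G") (auto simp: twins_outside_def)
qed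

text \<open>
  The conjunct \<open>l u = l u'\<close> makes the property survive later join and relabel operations: vertices
  with equal current labels are treated alike by them.
\<close>

definition balanced_subset ::
    "nat \<Rightarrow> 'a set \<Rightarrow> nat \<Rightarrow> 'a pair_pre_digraph \<Rightarrow> ('a \<Rightarrow> nat) \<Rightarrow> 'a set \<Rightarrow> ('a \<Rightarrow> nat) \<Rightarrow> bool" where
  "balanced_subset k W N G l X c \<longleftrightarrow>
     X \<subseteq> pverts G \<and> N \<le> 3 * card (W \<inter> X) \<and> 3 * card (W \<inter> X) \<le> 2 * N \<and> c ` X \<subseteq> {1..k} \<and>
     (\<forall>u\<in>X. \<forall>u'\<in>X. c u = c u' \<longrightarrow> l u = l u' \<and> twins_outside G X u u')"

text \<open>Lifts the property from either operand to a disjoint union, which adds no arcs at the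
  operand's vertices and keeps their labels.\<close>

lemma balanced_subset_superset:
  assumes X: "balanced_subset k W N G l X c"
    and "pverts G \<subseteq> pverts K"
    and "parcs G \<subseteq> pverts G \<times> pverts G"
    and arcs: "\<And>u v. u \<in> pverts G \<Longrightarrow> (u, v) \<in> parcs K \<longleftrightarrow> (u, v) \<in> parcs G"
    and lab: "\<And>u. u \<in> pverts G \<Longrightarrow> l' u = l u"
  shows "balanced_subset k W N K l' X c"
proof -
  have sub: "X \<subseteq> pverts G"
    using X unfolding balanced_subset_def by blast
  have "l' u = l' u' \<and> twins_outside K X u u'" if u: "u \<in> X" "u' \<in> X" "c u = c u'" for u u'
  proof -
    have "l u = l u'" and tw: "twins_outside G X u u'"
      using X u unfolding balanced_subset_def by blast+
    moreover have uG: "u \<in> pverts G" "u' \<in> pverts G"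
      using u sub by auto
    ultimately show ?thesis
      using lab twins_outside_superset[OF tw assms(2) arcs[OF uG(1)] arcs[OF uG(2)] assms(3)]
      by simp
  qed
  then show ?thesis
    using X assms(2) sub unfolding balanced_subset_def by blast
qed

text \<open>Descend into an operand as long as it holds more than \<open>2 * N / 3\<close> points of
  \<open>W\<close>; at the first disjoint union where neither does, one operand becomes
  \<open>X\<close>. Its labels at that moment are kept as \<open>c\<close>, because later
  relabelling may merge them.\<close>

lemma clique_expr_balanced_subset:
  assumes "clique_expr k G l" and "2 * N < 3 * card (W \<inter> pverts G)" and "N \<ge> 3"
  shows "\<exists>X c. balanced_subset k W N G l X c"
  using assms(1,2)
proof (induction)
  case (vertex i v)
  have "card (W \<inter> {v}) \<le> 1"
    using card_mono[of "{v}" "W \<inter> {v}"] by simp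
  then show ?case using vertex assms(3) by simp
next
  case (disjoint_union G l H m)
  note wfG = clique_expr_wf[OF disjoint_union.hyps(1)]
  note wfH = clique_expr_wf[OF disjoint_union.hyps(2)]
  note disj = disjoint_union.hyps(3)
  let ?K = "\<lparr>pverts = pverts G \<union> pverts H, parcs = parcs G \<union> parcs H\<rparr>"
  let ?l = "\<lambda>v. if v \<in> pverts G then l v else m v"
  have liftG: "balanced_subset k W N ?K ?l X c" if "balanced_subset k W N G l X c" for X c
  proof (rule balanced_subset_superset[OF that _ wfG(2)])
    show "(u, v) \<in> parcs ?K \<longleftrightarrow> (u, v) \<in> parcs G" if "u \<in> pverts G" for u v
      using that wfH(2) disj by auto
  qed auto
  have liftH: "balanced_subset k W N ?K ?l X c" if "balanced_subset k W N H m X c" for X c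
  proof (rule balanced_subset_superset[OF that _ wfH(2)])
    show "(u, v) \<in> parcs ?K \<longleftrightarrow> (u, v) \<in> parcs H" if "u \<in> pverts H" for u v
      using that wfG(2) disj by auto
    show "?l u = m u" if "u \<in> pverts H" for u
      using that disj by auto
  qed auto
  have card: "card (W \<inter> (pverts G \<union> pverts H)) = card (W \<inter> pverts G) + card (W \<inter> pverts H)"
    unfolding Int_Un_distrib using wfG(1) wfH(1) disj by (intro card_Un_disjoint) auto
  \<comment> \<open>If both shares are at most \<open>2 * N / 3\<close>, the larger one still
    exceeds \<open>N / 3\<close>, since their sum exceeds \<open>2 * N / 3\<close>.\<close>
  consider "2 * N < 3 * card (W \<inter> pverts G)" | "2 * N < 3 * card (W \<inter> pverts H)"
    | "3 * card (W \<inter> pverts G) \<le> 2 * N" "N \<le> 3 * card (W \<inter> pverts G)"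
    | "3 * card (W \<inter> pverts H) \<le> 2 * N" "N \<le> 3 * card (W \<inter> pverts H)"
    using disjoint_union.prems card by simp linarith
  then show ?case
  proof cases
    case 1
    then show ?thesis using disjoint_union.IH(1) liftG by blast
  next
    case 2
    then show ?thesis using disjoint_union.IH(2) liftH by blast
  next
    case 3
    \<comment> \<open>No vertex of the operand lies outside \<open>X\<close>, so the twin condition
      is vacuous at this point.\<close>
    then have "balanced_subset k W N G l (pverts G) l"
      using wfG(3) by (auto simp: balanced_subset_def twins_outside_def)
    then show ?thesis using liftG by blast
  next
    case 4
    then have "balanced_subset k W N H m (pverts H) m"
      using wfH(3) by (auto simp: balanced_subset_def twins_outside_def)
    then show ?thesis using liftH by blast
  qed
next
  case (join G l i j)
  then obtain X c where X: "balanced_subset k W N G l X c" by auto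
  let ?K = "\<lparr>pverts = pverts G, parcs = parcs G \<union> {(u, v). u \<in> pverts G \<and> v \<in> pverts G \<and>
     (l u = i \<and> l v = j \<or> l u = j \<and> l v = i)}\<rparr>"
  have "twins_outside ?K X u u'"
    if "u \<in> X" "u' \<in> X" "l u = l u'" "twins_outside G X u u'" for u u'
  proof -
    have "u \<in> pverts G" "u' \<in> pverts G"
      using that X unfolding balanced_subset_def by blast+
    then show ?thesis
      using that(3,4) by (simp add: twins_outside_def)
  qed
  then have "balanced_subset k W N ?K l X c"
    using X unfolding balanced_subset_def pair_pre_digraph.select_convs by blast
  then show ?case by blast
next
  case (relabel G l i j)
  then obtain X c where "balanced_subset k W N G l X c" by auto
  then have "balanced_subset k W N G (\<lambda>v. if l v = i then j else l v) X c"
    unfolding balanced_subset_def by metis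
  then show ?case by blast
qed

section \<open>Disjoint paths crossing a labelled set\<close>

lemma path_crosses:
  fixes f :: "nat \<Rightarrow> 'a"
  assumes "a \<le> L" "b \<le> L" "f a \<in> X" "f b \<notin> X"
  obtains x y where "x \<le> L" "y \<le> L" "y = Suc x \<or> x = Suc y" "f x \<in> X" "f y \<notin> X"
proof -
  have "f x \<in> X \<longleftrightarrow> f 0 \<in> X"
    if no: "\<not> (\<exists>x\<le>L. \<exists>y\<le>L. (y = Suc x \<or> x = Suc y) \<and> f x \<in> X \<and> f y \<notin> X)" and "x \<le> L" for x
    using \<open>x \<le> L\<close>
  proof (induction x)
    case (Suc x)
    then show ?case using no Suc_leD by blast
  qed simp
  then show ?thesis
    using assms that by metis
qed

text \<open>Each mixed path has an arc from some \<open>u j\<close> in \<open>X\<close> to some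
  \<open>v j\<close> outside, and disjointness makes the \<open>u j\<close> distinct. All
  \<open>u i\<close> with the same label as \<open>u j\<close> are its twins, hence neighbours of
  the single vertex \<open>v j\<close>, so each of the \<open>k\<close> labels occurs at most
  \<open>d\<close> times.\<close>

lemma card_crossing_paths_le:
  assumes sym: "\<And>u v. (u, v) \<in> parcs G \<Longrightarrow> (v, u) \<in> parcs G"
    and fin: "finite (pverts G)" and wf: "parcs G \<subseteq> pverts G \<times> pverts G"
    and deg: "\<And>v. v \<in> pverts G \<Longrightarrow> card {u. (u, v) \<in> parcs G} \<le> d"
    and lab: "c ` X \<subseteq> {1..k}"
    and hom: "\<And>u u'. u \<in> X \<Longrightarrow> u' \<in> X \<Longrightarrow> c u = c u' \<Longrightarrow> twins_outside G X u u'"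
    and path: "\<And>j x. j \<in> J \<Longrightarrow> x < L j \<Longrightarrow> (f j x, f j (Suc x)) \<in> parcs G"
    and disj: "\<And>i j x y. i \<in> J \<Longrightarrow> j \<in> J \<Longrightarrow> x \<le> L i \<Longrightarrow> y \<le> L j \<Longrightarrow> f i x = f j y \<Longrightarrow> i = j"
    and mixed: "\<And>j. j \<in> J \<Longrightarrow> \<exists>a\<le>L j. \<exists>b\<le>L j. f j a \<in> X \<and> f j b \<notin> X"
  shows "card J \<le> d * k"
proof -
  have "\<exists>x y. x \<le> L j \<and> f j x \<in> X \<and> f j y \<notin> X \<and> (f j x, f j y) \<in> parcs G" if j: "j \<in> J" for j
  proof -
    obtain a b where "a \<le> L j" "b \<le> L j" "f j a \<in> X" "f j b \<notin> X"
      using mixed[OF j] by blast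
    then obtain x y where xy: "x \<le> L j" "y \<le> L j" "y = Suc x \<or> x = Suc y" "f j x \<in> X" "f j y \<notin> X"
      by (rule path_crosses)
    moreover have "(f j x, f j y) \<in> parcs G"
      using xy(1-3) path[OF j, of x] path[OF j, of y] sym by auto
    ultimately show ?thesis by blast
  qed
  then obtain p q where pq: "\<And>j. j \<in> J \<Longrightarrow> p j \<le> L j \<and> f j (p j) \<in> X \<and> f j (q j) \<notin> X \<and>
      (f j (p j), f j (q j)) \<in> parcs G"
    by metis
  define u where "u j = f j (p j)" for j
  define v where "v j = f j (q j)" for j
  have uX: "u j \<in> X" and vX: "v j \<in> pverts G - X" and arc: "(u j, v j) \<in> parcs G" if "j \<in> J" for j
    using pq[OF that] wf by (auto simp: u_def v_def)
  have inj: "inj_on u J"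
    unfolding inj_on_def u_def by (metis disj pq)
  have "card {w \<in> u ` J. c w = e} \<le> d" if "e \<in> {1..k}" for e
  proof (cases "{w \<in> u ` J. c w = e} = {}")
    case False
    then obtain j where j: "j \<in> J" "c (u j) = e" by auto
    have "(u i, v j) \<in> parcs G" if "i \<in> J" "c (u i) = e" for i
      using hom[of "u j" "u i"] vX[OF j(1)] arc[OF j(1)] uX that j by (simp add: twins_outside_def)
    then have "{w \<in> u ` J. c w = e} \<subseteq> {w. (w, v j) \<in> parcs G}"
      by auto
    moreover have "finite {w. (w, v j) \<in> parcs G}"
      using wf by (intro finite_subset[OF _ fin]) auto
    ultimately show ?thesis
      using deg[of "v j"] vX[OF j(1)] by (meson DiffD1 card_mono le_trans)
  qed (simp only: card.empty)
  then have "(\<Sum>e\<in>{1..k}. card {w \<in> u ` J. c w = e}) \<le> (\<Sum>e\<in>{1..k}. d)"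
    by (rule sum_mono)
  moreover have "u ` J = (\<Union>e\<in>{1..k}. {w \<in> u ` J. c w = e})"
    using lab uX by auto
  then have "card (u ` J) \<le> (\<Sum>e\<in>{1..k}. card {w \<in> u ` J. c w = e})"
    using card_UN_le[of "{1..k}" "\<lambda>e. {w \<in> u ` J. c w = e}"] by simp
  ultimately show ?thesis
    using card_image[OF inj] by (simp add: mult.commute)
qed

section \<open>Partitions into intervals\<close>

text \<open>A partition into intervals is encoded by its set \<open>B\<close> of left endpoints, so
  that merging two neighbouring intervals means deleting one element of \<open>B\<close>.\<close>

definition block :: "nat \<Rightarrow> nat set \<Rightarrow> nat \<Rightarrow> nat set" where
  "block n B b = {y \<in> {1..n}. b \<le> y \<and> (\<forall>b'\<in>B. b' \<le> y \<longrightarrow> b' \<le> b)}"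

definition blocks :: "nat \<Rightarrow> nat set \<Rightarrow> nat set set" where
  "blocks n B = block n B ` B"

lemma start_in_block: "b \<in> B \<Longrightarrow> B \<subseteq> {1..n} \<Longrightarrow> b \<in> block n B b"
  by (auto simp: block_def)

lemma block_disjoint:
  assumes "b \<in> B" "b' \<in> B" "y \<in> block n B b" "y \<in> block n B b'"
  shows "b = b'"
  using assms by (auto simp: block_def intro: antisym)

lemma block_convex:
  assumes "x \<in> block n B b" "z \<in> block n B b" "x \<le> y" "y \<le> z"
  shows "y \<in> block n B b"
  using assms by (auto simp: block_def)

lemma inj_on_block: "B \<subseteq> {1..n} \<Longrightarrow> inj_on (block n B) B"
  by (metis block_disjoint inj_onI start_in_block)

lemma block_covers:
  assumes "1 \<in> B" "y \<in> {1..n}"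
  obtains b where "b \<in> B" "y \<in> block n B b"
proof -
  let ?S = "{b \<in> B. b \<le> y}"
  have "finite ?S" "1 \<in> ?S"
    using assms by auto
  then have "Max ?S \<in> ?S" "\<And>b. b \<in> ?S \<Longrightarrow> b \<le> Max ?S"
    by (metis Max_in empty_iff) (simp add: \<open>finite ?S\<close>)
  then show ?thesis
    using assms(2) that[of "Max ?S"] by (auto simp: block_def)
qed

lemma partition_on_blocks:
  assumes "1 \<in> B" "B \<subseteq> {1..n}"
  shows "partition_on {1..n} (blocks n B)"
proof (rule partition_onI)
  show "\<Union> (blocks n B) = {1..n}"
  proof
    show "\<Union> (blocks n B) \<subseteq> {1..n}"
      by (auto simp: blocks_def block_def)
    show "{1..n} \<subseteq> \<Union> (blocks n B)"
      using block_covers[OF assms(1)] unfolding blocks_def by blast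
  qed
  show "{} \<notin> blocks n B"
    using start_in_block assms(2) unfolding blocks_def by blast
  show "disjnt p q" if "p \<in> blocks n B" "q \<in> blocks n B" "p \<noteq> q" for p q
    using that block_disjoint unfolding blocks_def disjnt_def by blast
qed

text \<open>The block starting at \<open>x\<close> is absorbed by the block of its predecessor
  \<open>x - 1\<close>, whose start is \<open>p\<close>; all other blocks stay the same.\<close>

lemma merges_two_parts_blocks:
  assumes "1 \<in> B" "B \<subseteq> {1..n}" "x \<in> B" "x \<noteq> 1"
  shows "merges_two_parts (blocks n B) (blocks n (B - {x}))"
proof -
  have "x \<in> {1..n}"
    using assms(2,3) by blast
  then have x: "x - 1 \<in> {1..n}" "x \<ge> 2"
    using assms(4) by auto
  obtain p where p: "p \<in> B" "x - 1 \<in> block n B p"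
    using block_covers[OF assms(1) x(1)] .
  have px: "p < x" and pmax: "\<And>b. b \<in> B \<Longrightarrow> b < x \<Longrightarrow> b \<le> p"
    using p x by (auto simp: block_def)
  have "block n (B - {x}) p = block n B p \<union> block n B x"
    using px pmax p(1) assms(3) by (auto simp: block_def)
  moreover have "block n (B - {x}) b = block n B b" if "b \<in> B - {x, p}" for b
  proof -
    have "y \<in> block n (B - {x}) b \<longleftrightarrow> y \<in> block n B b" for y
    proof (cases "b < x \<and> x \<le> y")
      \<comment> \<open>The start \<open>p\<close> separates \<open>b\<close> from \<open>y\<close>,
        so \<open>y\<close> lies in neither block.\<close>
      case True
      then have "\<not> p \<le> b" "p \<le> y" "p \<noteq> x"
        using that pmax[of b] px by auto
      then show ?thesis
        using p(1) by (auto simp: block_def)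
    next
      case False
      then show ?thesis
        by (auto simp: block_def)
    qed
    then show ?thesis by blast
  qed
  moreover have "B - {x} = insert p (B - {x, p})"
    using p(1) px by auto
  ultimately have "blocks n (B - {x}) =
      insert (block n B p \<union> block n B x) (block n B ` (B - {x, p}))"
    unfolding blocks_def by (metis (no_types, lifting) image_cong image_insert)
  also have "block n B ` (B - {x, p}) = blocks n B - {block n B p, block n B x}"
    unfolding blocks_def using inj_on_image_set_diff[OF inj_on_block[OF assms(2)], of B "{x, p}"]
      assms(3) p(1) by auto
  finally have "blocks n (B - {x}) = insert (block n B p \<union> block n B x)
      (blocks n B - {block n B p, block n B x})" .
  moreover have "block n B p \<noteq> block n B x"
    using inj_on_block[OF assms(2)] p(1) assms(3) px by (auto dest: inj_onD)
  ultimately show ?thesis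
    unfolding merges_two_parts_def using p(1) assms(3) by (metis blocks_def imageI)
qed

text \<open>Here \<open>Q\<close> is an invariant that can be kept while deleting starts one at a
  time, from all singletons down to the single block starting at 1.\<close>

lemma partition_sequence_blocks:
  assumes G: "pverts G = {1..n}" and "n \<ge> 1" and top: "Q {1..n}"
    and step: "\<And>B. Q B \<Longrightarrow> 1 \<in> B \<Longrightarrow> B \<subseteq> {1..n} \<Longrightarrow> B \<noteq> {1} \<Longrightarrow> \<exists>x\<in>B - {1}. Q (B - {x})"
  obtains P where "partition_sequence G P"
    "\<And>i. i \<in> {1..n} \<Longrightarrow> \<exists>B. Q B \<and> 1 \<in> B \<and> B \<subseteq> {1..n} \<and> P i = blocks n B"
proof -
  have "\<forall>B. \<exists>x. Q B \<and> 1 \<in> B \<and> B \<subseteq> {1..n} \<and> B \<noteq> {1} \<longrightarrow> x \<in> B - {1} \<and> Q (B - {x})"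
  proof
    show "\<exists>x. Q B \<and> 1 \<in> B \<and> B \<subseteq> {1..n} \<and> B \<noteq> {1} \<longrightarrow> x \<in> B - {1} \<and> Q (B - {x})" for B
      using step[of B] by (cases "Q B \<and> 1 \<in> B \<and> B \<subseteq> {1..n} \<and> B \<noteq> {1}") (simp, blast, simp)
  qed
  then obtain g where g: "\<forall>B. Q B \<and> 1 \<in> B \<and> B \<subseteq> {1..n} \<and> B \<noteq> {1} \<longrightarrow>
      g B \<in> B - {1} \<and> Q (B - {g B})"
    unfolding choice_iff by (rule exE)
  \<comment> \<open>The starts left after \<open>j\<close> deletions; there are \<open>n - j\<close>
    of them, so the partition with \<open>i\<close> parts is reached at
    \<open>j = n - i\<close>.\<close>
  define f where "f j = ((\<lambda>B. B - {g B}) ^^ j) {1..n}" for j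
  have f_0: "f 0 = {1..n}" and f_Suc: "f (Suc j) = f j - {g (f j)}" for j
    by (simp_all add: f_def)
  have g_f: "g (f j) \<in> f j - {1} \<and> Q (f j - {g (f j)})"
    if "Q (f j)" "1 \<in> f j" "f j \<subseteq> {1..n}" "card (f j) = n - j" "Suc j < n" for j
  proof (rule g[rule_format], intro conjI)
    show "f j \<noteq> {1}"
    proof
      assume "f j = {1}"
      then have "card (f j) = 1" by simp
      then show False using that(4,5) by linarith
    qed
  qed (use that in blast)+
  have f: "Q (f j) \<and> 1 \<in> f j \<and> f j \<subseteq> {1..n} \<and> card (f j) = n - j" if "j < n" for j
    using that
  proof (induction j)
    case 0
    then show ?case using top f_0 by simp
  next
    case (Suc j)
    then have IH: "Q (f j)" "1 \<in> f j" "f j \<subseteq> {1..n}" "card (f j) = n - j" by auto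
    have "finite (f j)"
      using IH(3) finite_subset by blast
    then show ?case
      using g_f[OF IH Suc.prems] IH unfolding f_Suc by (auto simp: card_Diff_singleton)
  qed
  define P where "P i = blocks n (f (n - i))" for i
  have "f (n - 1) = {1}"
  proof -
    have "card (f (n - 1)) = 1" "1 \<in> f (n - 1)"
      using f[of "n - 1"] \<open>n \<ge> 1\<close> by simp_all
    then show ?thesis
      by (metis card_1_singletonE singletonD)
  qed
  moreover have "block n {1} 1 = {1..n}"
    unfolding block_def by auto
  ultimately have P1: "P 1 = {{1..n}}"
    by (simp add: P_def blocks_def)
  have Pn: "P n = {{v} |v. v \<in> {1..n}}"
  proof -
    have "block n {1..n} b = {b}" if "b \<in> {1..n}" for b
      using that unfolding block_def by (auto intro!: le_antisym)
    then have "block n {1..n} ` {1..n} = (\<lambda>b. {b}) ` {1..n}"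
      by (rule image_cong[OF refl])
    then show ?thesis
      unfolding P_def blocks_def diff_self_eq_0 f_0 by auto
  qed
  have "partition_sequence G P"
    unfolding partition_sequence_def G
  proof (intro conjI ballI)
    fix i assume "i \<in> {1..card {1..n}}"
    then show "partition_on {1..n} (P i)"
      unfolding P_def using f[of "n - i"] by (intro partition_on_blocks) auto
  next
    fix i assume i: "i \<in> {1..<card {1..n}}"
    define j where "j = n - Suc i"
    have j: "Suc j < n" "n - i = Suc j"
      using i by (auto simp: j_def)
    have "g (f j) \<in> f j - {1}"
      using g_f f[of j] j(1) by simp
    then show "merges_two_parts (P (Suc i)) (P i)"
      unfolding P_def j(2) j_def[symmetric] f_Suc
      using f[of j] j(1) by (intro merges_two_parts_blocks) auto
  qed (use P1 Pn in simp_all)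
  moreover have "\<exists>B. Q B \<and> 1 \<in> B \<and> B \<subseteq> {1..n} \<and> P i = blocks n B" if "i \<in> {1..n}" for i
    using f[of "n - i"] that unfolding P_def by (intro exI[of _ "f (n - i)"]) auto
  ultimately show ?thesis using that by blast
qed

section \<open>Spans and conflicts in the natural order\<close>

definition nat_order :: "nat \<Rightarrow> nat rel" where
  "nat_order n = {(a, b). a \<in> {1..n} \<and> b \<in> {1..n} \<and> a \<le> b}"

lemma linear_order_nat_order: "linear_order_on {1..n} (nat_order n)"
  by (auto simp: nat_order_def linear_order_on_def partial_order_on_def preorder_on_def
      refl_on_def trans_def antisym_def total_on_def)

lemma span_wrt_nat_order:
  assumes "X \<subseteq> {1..n}" "X \<noteq> {}"
  shows "span_wrt (nat_order n) X = {Min X..Max X}"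
proof -
  have fin: "finite X"
    using assms(1) finite_subset by blast
  have m: "Min X \<in> X" "Max X \<in> X" "\<And>y. y \<in> X \<Longrightarrow> Min X \<le> y \<and> y \<le> Max X"
    using fin assms(2) by auto
  have "min_wrt (nat_order n) X = Min X"
    unfolding min_wrt_def nat_order_def using m assms(1)
    by (intro the_equality) (auto intro!: antisym)
  moreover have "max_wrt (nat_order n) X = Max X"
    unfolding max_wrt_def nat_order_def using m assms(1)
    by (intro the_equality) (auto intro!: antisym)
  ultimately show ?thesis
    using m(1,2) assms(1) by (auto simp: span_wrt_def nat_order_def)
qed

text \<open>A block is convex and therefore contains its whole span, so a conflict provides an
  actual point of the block.\<close>

lemma in_conflict_block:
  assumes "B \<subseteq> {1..n}" "b \<in> B" "U \<subseteq> {1..n}" "U \<noteq> {}" "in_conflict (nat_order n) (block n B b) U"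
  obtains y where "y \<in> block n B b" "Min U \<le> y" "y \<le> Max U"
proof -
  let ?Y = "block n B b"
  have Y: "?Y \<subseteq> {1..n}" "?Y \<noteq> {}"
    using start_in_block[OF assms(2,1)] by (auto simp: block_def)
  have fin: "finite ?Y"
    using Y(1) finite_subset by blast
  obtain y where y: "Min ?Y \<le> y" "y \<le> Max ?Y" "Min U \<le> y" "y \<le> Max U"
    using assms(5) unfolding in_conflict_def span_wrt_nat_order[OF Y] span_wrt_nat_order[OF assms(3,4)]
    by (metis IntE atLeastAtMost_iff ex_in_conv)
  have "Min ?Y \<in> ?Y" "Max ?Y \<in> ?Y"
    using fin Y(2) by auto
  then have "y \<in> ?Y"
    using y(1,2) by (rule block_convex)
  then show ?thesis
    using that y by blast
qed

section \<open>Dyadic interval partitions\<close>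

text \<open>With these starts each multiple of \<open>2 ^ t\<close> is a block of its own, and the
  numbers strictly between consecutive multiples, which form a subtree below height
  \<open>t\<close>, are one block.\<close>

definition dyadic_starts :: "nat \<Rightarrow> nat set" where
  "dyadic_starts t = {x. 2 ^ t dvd x \<or> 2 ^ t dvd (x - 1)}"

lemma dyadic_starts_antimono: "s \<le> t \<Longrightarrow> dyadic_starts t \<subseteq> dyadic_starts s"
  unfolding dyadic_starts_def using le_imp_power_dvd[of s t "2::nat"] dvd_trans by blast

text \<open>Modulo \<open>2 ^ t\<close> a start is 0 or 1, and its quotient takes at most 13 values
  in the window.\<close>

lemma card_dyadic_starts_le:
  "card {z \<in> dyadic_starts t. L \<le> z \<and> z < L + 12 * 2 ^ t} \<le> 26"
proof -
  let ?S = "{z \<in> dyadic_starts t. L \<le> z \<and> z < L + 12 * 2 ^ t}"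
  let ?p = "L div 2 ^ t"
  let ?f = "\<lambda>(q, e). 2 ^ t * q + e :: nat"
  have "?S \<subseteq> ?f ` ({?p..?p + 12} \<times> {0, 1})"
  proof
    fix z assume z: "z \<in> ?S"
    have "z mod 2 ^ t \<in> {0, 1}"
    proof (cases "2 ^ t dvd z")
      case False
      then have "z \<noteq> 0" "2 ^ t dvd (z - 1)"
        using z unfolding dyadic_starts_def by (metis dvd_0_right, blast)
      then obtain q where "z = 2 ^ t * q + 1"
        by (metis Suc_eq_plus1 Suc_pred' dvdE gr0I)
      then have "z mod 2 ^ t = 1 mod 2 ^ t"
        by (simp only: mod_mult_self4)
      then show ?thesis
        by (cases t) auto
    qed (simp add: dvd_eq_mod_eq_0)
    moreover have "?p \<le> z div 2 ^ t"
      using z by (simp add: div_le_mono)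
    moreover have "z div 2 ^ t \<le> (L + 12 * 2 ^ t) div 2 ^ t"
      using z by (intro div_le_mono) simp
    then have "z div 2 ^ t \<le> ?p + 12"
      by simp
    moreover have "z = ?f (z div 2 ^ t, z mod 2 ^ t)"
      by simp
    ultimately show "z \<in> ?f ` ({?p..?p + 12} \<times> {0, 1})"
      by (intro image_eqI[of _ _ "(z div 2 ^ t, z mod 2 ^ t)"]) auto
  qed
  then have "card ?S \<le> card (?f ` ({?p..?p + 12} \<times> {0, 1}))"
    by (intro card_mono) auto
  also have "\<dots> \<le> card ({?p..?p + 12} \<times> {0::nat, 1})"
    by (intro card_image_le) auto
  also have "\<dots> = 26"
    by (simp add: card_cartesian_product)
  finally show ?thesis .
qed

text \<open>
  If \<open>B\<close> is squeezed between consecutive scales, then the blocks of \<open>B\<close> have length at most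
  \<open>2 ^ (t + 1)\<close>, multiples of \<open>2 ^ (t + 1)\<close> form singleton blocks, and only arcs whose endpoints
  differ by at most \<open>2 ^ (t + 1)\<close> can create red edges.
\<close>

definition dyadic_scale :: "nat \<Rightarrow> nat \<Rightarrow> nat set \<Rightarrow> bool" where
  "dyadic_scale n t B \<longleftrightarrow> {1..n} \<inter> dyadic_starts (Suc t) \<subseteq> B \<and> B \<subseteq> dyadic_starts t"

text \<open>Take the coarsest scale \<open>t\<close> with
  \<open>B \<subseteq> dyadic_starts t\<close> and delete a start that is missing at scale
  \<open>Suc t\<close>. Passing from \<open>s\<close> to \<open>t\<close> covers the case where
  scale \<open>s\<close> is already exhausted.\<close>

lemma dyadic_scale_step:
  assumes B: "dyadic_scale n s B" and "1 \<in> B" "B \<subseteq> {1..n}" "B \<noteq> {1}"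
  shows "\<exists>x\<in>B - {1}. \<exists>t. dyadic_scale n t (B - {x})"
proof -
  obtain y where y: "y \<in> B" "y \<noteq> 1"
    using assms(2,4) by blast
  let ?T = "\<lambda>t. B \<subseteq> dyadic_starts t"
  \<comment> \<open>One of the positive numbers \<open>y\<close> and \<open>y - 1\<close> is a
    multiple of \<open>2 ^ t\<close>, which bounds the possible scales.\<close>
  have bound: "t \<le> n" if "?T t" for t
  proof -
    have "y - 1 > 0" "y \<le> n"
      using y assms(3) by force+
    moreover have "2 ^ t dvd y \<or> 2 ^ t dvd (y - 1)"
      using that y(1) by (auto simp: dyadic_starts_def)
    ultimately have "2 ^ t \<le> n"
      by (metis diff_le_self dvd_imp_le le_trans less_le_trans)
    then show ?thesis
      using less_exp[of t] by linarith
  qed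
  have "?T s"
    using B by (simp add: dyadic_scale_def)
  then obtain t where t: "?T t" "\<And>t'. ?T t' \<Longrightarrow> t' \<le> t"
    using Nat.ex_has_greatest_nat[of ?T s n] bound by blast
  have "\<not> B \<subseteq> dyadic_starts (Suc t)"
    using t(2) by fastforce
  then obtain x where x: "x \<in> B" "x \<notin> dyadic_starts (Suc t)"
    by blast
  have "x \<noteq> 1"
    using x(2) by (auto simp: dyadic_starts_def)
  moreover have "dyadic_starts (Suc t) \<subseteq> dyadic_starts (Suc s)"
    using t(2)[OF \<open>?T s\<close>] by (intro dyadic_starts_antimono) simp
  then have "{1..n} \<inter> dyadic_starts (Suc t) \<subseteq> B"
    using B by (auto simp: dyadic_scale_def)
  then have "dyadic_scale n t (B - {x})"
    using t(1) x(2) by (auto simp: dyadic_scale_def)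
  ultimately show ?thesis
    using x(1) by blast
qed

text \<open>Both \<open>u\<close> and, if it is at most \<open>n\<close>, \<open>Suc u\<close> are
  starts.\<close>

lemma block_dyadic_singleton:
  assumes "dyadic_scale n t B" "u \<in> block n B b" "2 ^ Suc t dvd u"
  shows "block n B b = {u}"
proof -
  have u: "u \<in> {1..n}" "b \<le> u"
    using assms(2) by (auto simp: block_def)
  have "u \<in> B"
    using assms(1,3) u(1) by (auto simp: dyadic_scale_def dyadic_starts_def)
  then have b: "b = u"
    using assms(2) by (auto simp: block_def)
  have "y = u" if y: "y \<in> block n B b" for y
  proof (rule ccontr)
    assume "y \<noteq> u"
    then have "Suc u \<le> y" "y \<le> n"
      using y b by (auto simp: block_def)
    moreover from this have "Suc u \<in> B"
      using assms(1,3) by (auto simp: dyadic_scale_def dyadic_starts_def)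
    ultimately show False
      using y b by (auto simp: block_def)
  qed
  then show ?thesis
    using assms(2) by blast
qed

text \<open>The last multiple \<open>q\<close> of \<open>2 ^ Suc t\<close> up to \<open>y\<close> is
  0 or a start, so the block cannot begin before it.\<close>

lemma block_dyadic_diameter:
  assumes "dyadic_scale n t B" "y \<in> block n B b"
  shows "y < b + 2 ^ Suc t"
proof -
  define d :: nat where "d = 2 ^ Suc t"
  define q where "q = d * (y div d)"
  have "d > 0"
    by (simp add: d_def)
  then have q: "q \<le> y" "y < q + d"
    unfolding q_def using mult_div_mod_eq[of d y] mod_less_divisor[of d y] by linarith+
  have "q \<le> b"
  proof (cases "q = 0")
    case False
    then have "q \<in> {1..n}"
      using q(1) assms(2) by (auto simp: block_def)
    moreover have "q \<in> dyadic_starts (Suc t)"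
      by (simp add: dyadic_starts_def q_def d_def)
    ultimately have "q \<in> B"
      using assms(1) by (auto simp: dyadic_scale_def)
    then show ?thesis
      using q(1) assms(2) by (auto simp: block_def)
  qed simp
  then show ?thesis
    using q(2) by (simp add: d_def)
qed

section \<open>Stretch of dyadic partitions\<close>

text \<open>This isolates the property of arcs behind the stretch bound. In the binary tree with
  level paths, \<open>i\<close> is the height of the lower endpoint.\<close>

locale dyadic_arcs =
  fixes G :: "nat pair_pre_digraph" and n :: nat
  assumes verts: "pverts G = {1..n}"
    and dyadic: "(u, v) \<in> parcs G \<Longrightarrow>
      \<exists>i. 2 ^ i dvd u \<and> 2 ^ i dvd v \<and> u \<le> v + 2 ^ Suc i \<and> v \<le> u + 2 ^ Suc i"
begin

text \<open>An arc with \<open>i > t\<close> joins two singleton blocks, which are homogeneous.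
  Hence a red edge comes from an arc of length at most \<open>2 ^ Suc t\<close>, and the rest is the
  diameter of the two blocks.\<close>

lemma inhomogeneous_block_near:
  assumes B: "dyadic_scale n t B" and inh: "inhomogeneous G (block n B b) (block n B b')"
    and y: "y \<in> block n B b'"
  shows "b < y + 2 * 2 ^ Suc t \<and> y < b + 3 * 2 ^ Suc t"
proof -
  obtain u v u' v' where uv: "u \<in> block n B b" "v \<in> block n B b'" "(u, v) \<in> parcs G"
    and uv': "u' \<in> block n B b" "v' \<in> block n B b'" "(u', v') \<notin> parcs G"
    using inh by (auto simp: inhomogeneous_def)
  obtain i where i: "2 ^ i dvd u" "2 ^ i dvd v" "u \<le> v + 2 ^ Suc i" "v \<le> u + 2 ^ Suc i"
    using dyadic[OF uv(3)] by blast
  have "i \<le> t"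
  proof (rule ccontr)
    assume "\<not> i \<le> t"
    then have "(2::nat) ^ Suc t dvd 2 ^ i"
      by (intro le_imp_power_dvd) simp
    then have "2 ^ Suc t dvd u" "2 ^ Suc t dvd v"
      using i(1,2) dvd_trans by blast+
    then have "u' = u" "v' = v"
      using block_dyadic_singleton[OF B uv(1)] block_dyadic_singleton[OF B uv(2)] uv' by auto
    then show False
      using uv(3) uv'(3) by simp
  qed
  then have "(2::nat) ^ Suc i \<le> 2 ^ Suc t"
    by (intro power_increasing) auto
  moreover have "u < b + 2 ^ Suc t" "y < b' + 2 ^ Suc t" "v < b' + 2 ^ Suc t"
    using block_dyadic_diameter[OF B] uv y by blast+
  moreover have "b \<le> u" "b' \<le> v" "b' \<le> y"
    using uv y by (auto simp: block_def)
  ultimately show ?thesis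
    using i(3,4) by linarith
qed

lemma part_stretch_le:
  assumes B: "dyadic_scale n t B" and BV: "B \<subseteq> {1..n}" and b: "b \<in> B"
  shows "part_stretch G (nat_order n) (blocks n B) (block n B b) \<le> 26"
proof -
  let ?X = "block n B b" and ?P = "blocks n B"
  define d :: nat where "d = 2 ^ Suc t"
  define U where "U = \<Union>(closed_neighborhood (red_graph G ?P) ?X)"
  \<comment> \<open>The closed red neighbourhood lies strictly between \<open>b - 2 * d\<close> and
    \<open>b + 3 * d\<close>, and a block meeting this range starts less than \<open>d\<close>
    before it. The window length is \<open>6 * d\<close>; truncated subtraction can only extend the
    window to the right.\<close>
  let ?S = "{z \<in> dyadic_starts t. b - 3 * d \<le> z \<and> z < (b - 3 * d) + 12 * 2 ^ t}"
  have U: "b < y + 2 * d \<and> y < b + 3 * d" "y \<in> {1..n}" if y: "y \<in> U" for y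
  proof -
    obtain Y where Y: "Y = ?X \<or> Y \<in> ?P \<and> inhomogeneous G ?X Y" "y \<in> Y"
      using y unfolding U_def closed_neighborhood_def red_graph_def by simp blast
    have d: "d > 0" by (simp add: d_def)
    have "(b < y + 2 * d \<and> y < b + 3 * d) \<and> y \<in> {1..n}"
    proof (cases "Y = ?X")
      case True
      then have "y < b + d" "b \<le> y" "y \<in> {1..n}"
        using block_dyadic_diameter[OF B, of y b] Y(2) by (simp_all add: d_def block_def)
      then show ?thesis using d by linarith
    next
      case False
      then obtain b' where b': "Y = block n B b'" "inhomogeneous G ?X (block n B b')"
        using Y(1) unfolding blocks_def by blast
      moreover have "y \<in> {1..n}"
        using b' Y(2) by (simp add: block_def)
      ultimately show ?thesis
        using inhomogeneous_block_near[OF B b'(2), of y] Y(2) by (simp add: d_def)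
    qed
    then show "b < y + 2 * d \<and> y < b + 3 * d" "y \<in> {1..n}" by blast+
  qed
  have Une: "U \<noteq> {}" "finite U" "U \<subseteq> {1..n}"
  proof -
    show "U \<subseteq> {1..n}" using U(2) by blast
    then show "finite U" using finite_subset by blast
    show "U \<noteq> {}"
      using start_in_block[OF b BV] unfolding U_def closed_neighborhood_def by blast
  qed
  have "{Y. interferes G (nat_order n) ?P Y ?X} \<subseteq> block n B ` ?S"
  proof
    fix Y assume "Y \<in> {Y. interferes G (nat_order n) ?P Y ?X}"
    then have "Y \<in> ?P" and conf: "in_conflict (nat_order n) Y U"
      by (simp_all add: interferes_def U_def)
    then obtain z where z: "z \<in> B" "Y = block n B z"
      by (auto simp: blocks_def)
    obtain w where w: "w \<in> block n B z" "Min U \<le> w" "w \<le> Max U"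
      using in_conflict_block[OF BV z(1) Une(3,1)] conf z(2) by blast
    have "b < Min U + 2 * d" "Max U < b + 3 * d"
      using U(1) Une by auto
    moreover have "z \<le> w"
      using w(1) by (simp add: block_def)
    moreover have "w < z + d"
      using block_dyadic_diameter[OF B w(1)] by (simp add: d_def)
    moreover have "12 * 2 ^ t = 6 * d"
      by (simp add: d_def)
    ultimately have "b - 3 * d \<le> z \<and> z < (b - 3 * d) + 12 * 2 ^ t"
      using w(2,3) by linarith
    moreover have "z \<in> dyadic_starts t"
      using z(1) B by (auto simp: dyadic_scale_def)
    ultimately show "Y \<in> block n B ` ?S"
      using z(2) by blast
  qed
  moreover have "finite ?S" by simp
  ultimately have "card {Y. interferes G (nat_order n) ?P Y ?X} \<le> card (block n B ` ?S)"
    by (intro card_mono) auto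
  also have "\<dots> \<le> card ?S"
    by (rule card_image_le) simp
  also have "\<dots> \<le> 26"
    by (rule card_dyadic_starts_le)
  finally show ?thesis
    by (simp add: part_stretch_def)
qed

lemma stretch_width_le:
  assumes "n \<ge> 1"
  shows "stretch_width G \<le> 26"
proof -
  let ?r = "nat_order n"
  have top: "\<exists>t. dyadic_scale n t {1..n}"
    by (rule exI[of _ 0]) (auto simp: dyadic_scale_def dyadic_starts_def)
  obtain P where P: "partition_sequence G P"
    "\<And>i. i \<in> {1..n} \<Longrightarrow> \<exists>B. (\<exists>t. dyadic_scale n t B) \<and> 1 \<in> B \<and> B \<subseteq> {1..n} \<and> P i = blocks n B"
    using partition_sequence_blocks[where Q = "\<lambda>B. \<exists>t. dyadic_scale n t B",
        OF verts assms top] dyadic_scale_step by metis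
  have le: "partition_stretch G ?r (P i) \<le> 26" if i: "i \<in> {1..n}" for i
  proof -
    obtain B t where B: "dyadic_scale n t B" "1 \<in> B" "B \<subseteq> {1..n}" "P i = blocks n B"
      using P(2)[OF i] by blast
    have "finite B"
      using B(3) finite_subset by blast
    then have "finite (part_stretch G ?r (P i) ` P i)" "part_stretch G ?r (P i) ` P i \<noteq> {}"
      using B(2,4) by (auto simp: blocks_def)
    then show ?thesis
      unfolding partition_stretch_def using part_stretch_le[OF B(1,3)] B(4)
      by (subst Max_le_iff) (auto simp: blocks_def)
  qed
  let ?M = "\<lambda>P. Max ((\<lambda>i. partition_stretch G ?r (P i)) ` {1..graph_order G})"
  have "?M P \<le> 26"
    using le assms by (subst Max_le_iff) (auto simp: verts)
  moreover have "stretch_width_wrt G ?r \<le> ?M P"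
    unfolding stretch_width_wrt_def using P(1) by (intro cInf_lower) auto
  moreover have "stretch_width G \<le> stretch_width_wrt G ?r"
    unfolding stretch_width_def using linear_order_nat_order by (intro cInf_lower) (auto simp: verts)
  ultimately show ?thesis by linarith
qed

end

section \<open>The binary tree with level paths\<close>

text \<open>
  In the in-order numbering of the complete binary tree, \<open>(2 * a + 1) * 2 ^ i\<close> is the \<open>a\<close>-th node at
  height \<open>i\<close>. It is joined to the next node at the same height and, if it is a left child, to its
  parent.
\<close>

definition dyadic_adj :: "nat \<Rightarrow> nat \<Rightarrow> bool" where
  "dyadic_adj u v \<longleftrightarrow> (\<exists>i a. u = (2 * a + 1) * 2 ^ i \<and>
     (v = (2 * a + 3) * 2 ^ i \<or> even a \<and> v = (2 * a + 2) * 2 ^ i))"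

text \<open>The infinite pattern is cut at \<open>m * 2 ^ m\<close>, leaving \<open>m\<close>
  consecutive intervals of length \<open>2 ^ m\<close>, each of which will carry one column of the
  grid.\<close>

definition dyadic_grid :: "nat \<Rightarrow> nat pair_pre_digraph" where
  "dyadic_grid m =
     \<lparr>pverts = {1..m * 2 ^ m},
      parcs = {(u, v). u \<in> {1..m * 2 ^ m} \<and> v \<in> {1..m * 2 ^ m} \<and> (dyadic_adj u v \<or> dyadic_adj v u)}\<rparr>"

lemma dyadic_adj_less: "dyadic_adj u v \<Longrightarrow> u < v"
  unfolding dyadic_adj_def by (elim exE conjE disjE) (simp_all only: mult_less_cancel2, simp_all)

lemma dyadic_adj_near:
  assumes "dyadic_adj u v"
  shows "\<exists>i. 2 ^ i dvd u \<and> 2 ^ i dvd v \<and> u \<le> v + 2 ^ Suc i \<and> v \<le> u + 2 ^ Suc i"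
proof -
  obtain i a where "u = (2 * a + 1) * 2 ^ i" "v = (2 * a + 3) * 2 ^ i \<or> v = (2 * a + 2) * 2 ^ i"
    using assms unfolding dyadic_adj_def by blast
  then show ?thesis
    by (intro exI[of _ i]) (auto simp: algebra_simps)
qed

lemma pair_graph_dyadic_grid: "pair_graph (dyadic_grid m)"
proof
  show "finite (parcs (dyadic_grid m))"
    by (rule finite_subset[of _ "{1..m * 2 ^ m} \<times> {1..m * 2 ^ m}"]) (auto simp: dyadic_grid_def)
  show "symmetric (with_proj (dyadic_grid m))"
    by (auto simp: symmetric_def sym_def dyadic_grid_def)
qed (auto simp: dyadic_grid_def dest: dyadic_adj_less)

lemma stretch_width_dyadic_grid_le:
  assumes "m \<ge> 1"
  shows "stretch_width (dyadic_grid m) \<le> 26"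
proof -
  interpret dyadic_arcs "dyadic_grid m" "m * 2 ^ m"
  proof
    show "pverts (dyadic_grid m) = {1..m * 2 ^ m}"
      by (simp add: dyadic_grid_def)
  next
    fix u v assume "(u, v) \<in> parcs (dyadic_grid m)"
    then have "dyadic_adj u v \<or> dyadic_adj v u"
      by (simp add: dyadic_grid_def)
    then show "\<exists>i. 2 ^ i dvd u \<and> 2 ^ i dvd v \<and> u \<le> v + 2 ^ Suc i \<and> v \<le> u + 2 ^ Suc i"
      using dyadic_adj_near by blast
  qed
  show ?thesis
    using assms by (intro stretch_width_le) simp
qed

section \<open>Height and position as coordinates, and the degree bound\<close>

lemma odd_mult_power2_eq_iff:
  fixes a b :: nat
  shows "(2 * a + 1) * 2 ^ i = (2 * b + 1) * 2 ^ j \<longleftrightarrow> a = b \<and> i = j"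
proof
  assume "(2 * a + 1) * 2 ^ i = (2 * b + 1) * 2 ^ j"
  then show "a = b \<and> i = j"
  proof (induction i arbitrary: j)
    case 0
    show ?case
    proof (cases j)
      case (Suc k)
      then have "2 * a + 1 = 2 * ((2 * b + 1) * 2 ^ k)"
        using 0 by simp
      then show ?thesis by presburger
    qed (use 0 in simp)
  next
    case (Suc i)
    show ?case
    proof (cases j)
      case 0
      then have "2 * ((2 * a + 1) * 2 ^ i) = 2 * b + 1"
        using Suc.prems by simp
      then show ?thesis by presburger
    next
      case (Suc k)
      then have "(2 * a + 1) * 2 ^ i = (2 * b + 1) * 2 ^ k"
        using Suc.prems by simp
      then show ?thesis
        using Suc.IH \<open>j = Suc k\<close> by simp
    qed
  qed
qed simp

lemma odd_mult_power2_exists: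
  fixes v :: nat
  shows "v > 0 \<Longrightarrow> \<exists>i a. v = (2 * a + 1) * 2 ^ i"
proof (induction v rule: less_induct)
  case (less v)
  show ?case
  proof (cases "even v")
    case True
    then obtain w where w: "v = 2 * w" by (elim evenE)
    with less.prems have "w < v" "w > 0" by simp_all
    from less.IH[OF this] obtain i a where "w = (2 * a + 1) * 2 ^ i" by blast
    then show ?thesis
      using w by (intro exI[of _ "Suc i"] exI[of _ a]) simp
  next
    case False
    then show ?thesis
      by (intro exI[of _ 0] exI[of _ "v div 2"]) simp
  qed
qed

lemma card_dyadic_neighbors_le:
  assumes "v > 0"
  shows "card {u. (u, v) \<in> parcs (dyadic_grid m)} \<le> 4"
proof -
  obtain i a where v: "v = (2 * a + 1) * 2 ^ i"
    using odd_mult_power2_exists[OF assms] by blast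
  have up: "u \<in> {(2 * a + 3) * 2 ^ i, (2 * a + 2) * 2 ^ i}" if "dyadic_adj v u" for u
    using that unfolding dyadic_adj_def v odd_mult_power2_eq_iff by auto
  have down: "u \<in> {(2 * a - 1) * 2 ^ i, (4 * a + 1) * 2 ^ (i - 1)}" if "dyadic_adj u v" for u
  proof -
    obtain j b where u: "u = (2 * b + 1) * 2 ^ j"
      and b: "v = (2 * b + 3) * 2 ^ j \<or> even b \<and> v = (2 * b + 2) * 2 ^ j"
      using \<open>dyadic_adj u v\<close> unfolding dyadic_adj_def by blast
    from b show ?thesis
    proof (elim disjE conjE evenE)
      assume "v = (2 * b + 3) * 2 ^ j"
      moreover have "2 * b + 3 = 2 * Suc b + 1" by simp
      ultimately have "(2 * a + 1) * 2 ^ i = (2 * Suc b + 1) * 2 ^ j"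
        using v by metis
      then have "a = Suc b" "i = j"
        unfolding odd_mult_power2_eq_iff by simp_all
      then show ?thesis
        using u by simp
    next
      fix c assume c: "b = 2 * c" and "v = (2 * b + 2) * 2 ^ j"
      then have "(2 * a + 1) * 2 ^ i = (2 * c + 1) * 2 ^ Suc j"
        using v by simp
      then have "a = c" "i = Suc j"
        unfolding odd_mult_power2_eq_iff by simp_all
      then show ?thesis
        using u c by simp
    qed
  qed
  let ?N = "[(2 * a + 3) * 2 ^ i, (2 * a + 2) * 2 ^ i, (2 * a - 1) * 2 ^ i, (4 * a + 1) * 2 ^ (i - 1)]"
  have "{u. (u, v) \<in> parcs (dyadic_grid m)} \<subseteq> set ?N"
  proof
    fix u assume "u \<in> {u. (u, v) \<in> parcs (dyadic_grid m)}"
    then have "dyadic_adj u v \<or> dyadic_adj v u"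
      by (simp add: dyadic_grid_def)
    then show "u \<in> set ?N"
      using up[of u] down[of u] unfolding list.set by blast
  qed
  then have "card {u. (u, v) \<in> parcs (dyadic_grid m)} \<le> card (set ?N)"
    by (rule card_mono[OF List.finite_set])
  also have "\<dots> \<le> length ?N"
    by (rule card_length)
  finally show ?thesis by simp
qed

text \<open>
  Column \<open>c\<close> is the leftmost branch of the \<open>c\<close>-th subtree of height \<open>m - 1\<close>; it meets the row at
  height \<open>i\<close> in this vertex.
\<close>

definition crossing_point :: "nat \<Rightarrow> nat \<Rightarrow> nat \<Rightarrow> nat" where
  "crossing_point m c i = c * 2 ^ m + 2 ^ i"

text \<open>This exhibits the height \<open>i\<close> and the position within the row, so crossing
  points can be compared by uniqueness of these coordinates.\<close>

lemma crossing_point_conv_odd: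
  assumes "i < m"
  shows "crossing_point m c i = (2 * (c * 2 ^ (m - Suc i)) + 1) * 2 ^ i"
proof -
  have "(2::nat) ^ m = 2 ^ Suc (m - Suc i) * 2 ^ i"
    using assms by (simp flip: power_add power_Suc)
  then show ?thesis
    by (simp add: crossing_point_def algebra_simps)
qed

lemma crossing_point_eq_iff:
  assumes "i < m" "j < m"
  shows "crossing_point m c i = crossing_point m d j \<longleftrightarrow> c = d \<and> i = j"
  unfolding crossing_point_conv_odd[OF assms(1)] crossing_point_conv_odd[OF assms(2)]
    odd_mult_power2_eq_iff by auto

lemma crossing_point_in_grid:
  assumes "c < m" "i < m"
  shows "crossing_point m c i \<in> {1..m * 2 ^ m}"
proof -
  have "(2::nat) ^ i \<le> 2 ^ m"
    using assms(2) by (intro power_increasing) auto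
  then have "crossing_point m c i \<le> (c + 1) * 2 ^ m"
    by (simp add: crossing_point_def)
  also have "\<dots> \<le> m * 2 ^ m"
    using assms(1) by (intro mult_right_mono) auto
  finally show ?thesis
    by (simp add: crossing_point_def Suc_le_eq)
qed

text \<open>The bound on \<open>a\<close> ends the row at its crossing with the last column, which
  is still a vertex.\<close>

lemma row_arc:
  assumes i: "i < m" and a: "a < (m - 1) * 2 ^ (m - Suc i)"
  shows "((2 * a + 1) * 2 ^ i, (2 * Suc a + 1) * 2 ^ i) \<in> parcs (dyadic_grid m)"
proof -
  have "(2 * Suc a + 1) * 2 ^ i \<le> (2 * ((m - 1) * 2 ^ (m - Suc i)) + 1) * 2 ^ i"
    using a by (intro mult_right_mono) auto
  also have "\<dots> = crossing_point m (m - 1) i"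
    by (rule crossing_point_conv_odd[OF i, symmetric])
  also have "\<dots> \<le> m * 2 ^ m"
    using crossing_point_in_grid[of "m - 1" m i] i by auto
  finally have "(2 * Suc a + 1) * 2 ^ i \<le> m * 2 ^ m" .
  moreover have "(2 * a + 1) * 2 ^ i \<le> (2 * Suc a + 1) * 2 ^ i"
    by (intro mult_right_mono) auto
  moreover have "dyadic_adj ((2 * a + 1) * 2 ^ i) ((2 * Suc a + 1) * 2 ^ i)"
    unfolding dyadic_adj_def by (intro exI[of _ i] exI[of _ a]) (simp add: eval_nat_numeral)
  ultimately show ?thesis
    unfolding dyadic_grid_def by (simp add: Suc_le_eq)
qed

text \<open>As \<open>Suc i < m\<close>, the position in the row is even, so the vertex is a left
  child, and its parent is the next crossing point.\<close>

lemma column_arc: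
  assumes "c < m" "Suc i < m"
  shows "(crossing_point m c i, crossing_point m c (Suc i)) \<in> parcs (dyadic_grid m)"
proof -
  let ?a = "c * 2 ^ (m - Suc i)"
  have "crossing_point m c i = (2 * ?a + 1) * 2 ^ i"
    using assms(2) by (intro crossing_point_conv_odd) simp
  moreover from this have "crossing_point m c (Suc i) = (2 * ?a + 2) * 2 ^ i"
    by (simp add: crossing_point_def)
  moreover have "even ?a"
    using assms(2) by simp
  ultimately have "dyadic_adj (crossing_point m c i) (crossing_point m c (Suc i))"
    unfolding dyadic_adj_def by blast
  then show ?thesis
    using crossing_point_in_grid[of c m i] crossing_point_in_grid[of c m "Suc i"] assms
    by (simp add: dyadic_grid_def)
qed

text \<open>The factor 12 combines the degree bound 4 with the third of the columns guaranteed when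
  some row is not mixed.\<close>

lemma clique_width_dyadic_grid_ge:
  assumes m: "m \<ge> 2"
  shows "m \<le> 12 * clique_width (dyadic_grid m)"
proof -
  let ?G = "dyadic_grid m" and ?k = "clique_width (dyadic_grid m)"
  let ?w = "crossing_point m" and ?row = "\<lambda>i a. (2 * a + 1) * 2 ^ i :: nat"
  let ?p = "\<lambda>i c. c * 2 ^ (m - Suc i) :: nat"
  define W where "W = (\<lambda>(c, i). ?w c i) ` ({..<m} \<times> {..<m})"
  interpret G: pair_graph ?G
    by (rule pair_graph_dyadic_grid)
  have V: "pverts ?G = {1..m * 2 ^ m}"
    by (simp add: dyadic_grid_def)
  have "pverts ?G \<noteq> {}"
    using m by (simp add: V)
  then have "\<exists>k l. clique_expr k ?G l"
    using clique_expr_exists[OF pair_graph_dyadic_grid] by blast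
  then obtain l where l: "clique_expr ?k ?G l"
    unfolding clique_width_def by (rule LeastI_ex[THEN exE])
  have WV: "W \<subseteq> pverts ?G"
    using crossing_point_in_grid unfolding W_def V by fast
  have "inj_on (\<lambda>(c, i). ?w c i) ({..<m} \<times> {..<m})"
    by (auto simp: inj_on_def crossing_point_eq_iff)
  then have cardW: "card W = m * m"
    unfolding W_def by (simp add: card_image card_cartesian_product)
  have finW: "finite W"
    by (simp add: W_def)
  have "m * m \<ge> 2 * 2"
    using m by (intro mult_le_mono)
  moreover have "card (W \<inter> pverts ?G) = m * m"
    using WV cardW by (simp add: Int_absorb2)
  ultimately have "2 * (m * m) < 3 * card (W \<inter> pverts ?G)" "3 \<le> m * m"
    by linarith+
  from clique_expr_balanced_subset[OF l this] obtain X c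
    where X: "balanced_subset ?k W (m * m) ?G l X c" by blast
  have X_card: "m * m \<le> 3 * card (W \<inter> X)" "3 * card (W \<inter> X) \<le> 2 * (m * m)"
    and X_lab: "c ` X \<subseteq> {1..?k}"
    and X_twins: "\<And>u u'. u \<in> X \<Longrightarrow> u' \<in> X \<Longrightarrow> c u = c u' \<Longrightarrow> twins_outside ?G X u u'"
    using X unfolding balanced_subset_def by blast+
  have sym: "(v, u) \<in> parcs ?G" if "(u, v) \<in> parcs ?G" for u v
    using that by (auto simp: dyadic_grid_def)
  have wf: "parcs ?G \<subseteq> pverts ?G \<times> pverts ?G"
    by (auto simp: dyadic_grid_def)
  have deg: "card {u. (u, v) \<in> parcs ?G} \<le> 4" if "v \<in> pverts ?G" for v
    using that by (intro card_dyadic_neighbors_le) (simp add: V)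
  note crossing = card_crossing_paths_le[OF sym G.pair_finite_verts wf deg X_lab X_twins]
  show ?thesis
  \<comment> \<open>Either every row has crossing points on both sides of \<open>X\<close>, and the
    rows serve as paths, or some row is pure and the mixed columns do.\<close>
  proof (cases "\<forall>i<m. \<exists>a<m. \<exists>b<m. ?w a i \<in> X \<and> ?w b i \<notin> X")
    case True
    have "card {..<m} \<le> 4 * ?k"
    proof (rule crossing[where f = ?row and L = "\<lambda>i. ?p i (m - 1)"])
      show "(?row i a, ?row i (Suc a)) \<in> parcs ?G" if "i \<in> {..<m}" "a < ?p i (m - 1)" for i a
        using row_arc that by simp
      show "i = j" if "?row i a = ?row j b" for i j a b
        using that unfolding odd_mult_power2_eq_iff by blast
      show "\<exists>a\<le>?p i (m - 1). \<exists>b\<le>?p i (m - 1). ?row i a \<in> X \<and> ?row i b \<notin> X"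
        if i: "i \<in> {..<m}" for i
      proof -
        obtain a b where ab: "a < m" "b < m" "?w a i \<in> X" "?w b i \<notin> X"
          using True i by auto
        have "?p i a \<le> ?p i (m - 1)" "?p i b \<le> ?p i (m - 1)"
          using ab(1,2) by (intro mult_right_mono; simp)+
        moreover have "?row i (?p i a) \<in> X" "?row i (?p i b) \<notin> X"
          using ab(3,4) i crossing_point_conv_odd[of i m] by simp_all
        ultimately show ?thesis by blast
      qed
    qed
    then show ?thesis by simp
  next
    case False
    then obtain i where i: "i < m" "(\<forall>a<m. ?w a i \<in> X) \<or> (\<forall>a<m. ?w a i \<notin> X)"
      by blast
    define J where "J = {a. a < m \<and> (\<exists>j<m. \<exists>j'<m. ?w a j \<in> X \<and> ?w a j' \<notin> X)}"
    have "card J \<le> 4 * ?k"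
    proof (rule crossing[where f = ?w and L = "\<lambda>_. m - 1"])
      show "(?w a j, ?w a (Suc j)) \<in> parcs ?G" if "a \<in> J" "j < m - 1" for a j
        using column_arc[of a m j] that by (simp add: J_def)
      show "a = b" if "j \<le> m - 1" "j' \<le> m - 1" "?w a j = ?w b j'" for a b j j'
        using that m crossing_point_eq_iff[of j m j' a b] by simp
      show "\<exists>j\<le>m - 1. \<exists>j'\<le>m - 1. ?w a j \<in> X \<and> ?w a j' \<notin> X" if a: "a \<in> J" for a
      proof -
        obtain j j' where "j < m" "j' < m" "?w a j \<in> X \<and> ?w a j' \<notin> X"
          using a by (auto simp: J_def)
        moreover from this have "j \<le> m - 1" "j' \<le> m - 1" by simp_all
        ultimately show ?thesis by blast
      qed
    qed
    moreover have "m * m \<le> 3 * (card J * m)"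
    proof -
      \<comment> \<open>Applied to the crossing points on the side of \<open>X\<close> that the pure
        row avoids. A column through such a point also meets the pure row and is therefore mixed,
        and that side holds at least a third of \<open>W\<close>.\<close>
      have in_columns: "3 * card Z \<le> 3 * (card J * m)"
        if Z: "Z \<subseteq> W" "\<And>a j. a < m \<Longrightarrow> j < m \<Longrightarrow> ?w a j \<in> Z \<Longrightarrow> a \<in> J" for Z
      proof -
        have "Z \<subseteq> (\<lambda>(c, i). ?w c i) ` (J \<times> {..<m})"
          using Z unfolding W_def by fast
        moreover have "finite J"
          by (simp add: J_def)
        ultimately have "card Z \<le> card (J \<times> {..<m})"
          by (intro surj_card_le) auto
        then show ?thesis
          by (simp add: card_cartesian_product)
      qed
      from i(2) show ?thesis
      proof
        assume "\<forall>a<m. ?w a i \<in> X"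
        then have "3 * card (W - X) \<le> 3 * (card J * m)"
          using i(1) by (intro in_columns) (auto simp: J_def)
        moreover have "card (W - X) = m * m - card (W \<inter> X)"
          using card_Diff_subset_Int[of W X] finW cardW by simp
        ultimately show ?thesis
          using X_card(2) by linarith
      next
        assume "\<forall>a<m. ?w a i \<notin> X"
        then have "3 * card (W \<inter> X) \<le> 3 * (card J * m)"
          using i(1) by (intro in_columns) (auto simp: J_def)
        then show ?thesis
          using X_card(1) by linarith
      qed
    qed
    then have "m \<le> 3 * card J"
      using m by (simp flip: mult.assoc)
    ultimately show ?thesis by linarith
  qed
qed

section \<open>Asymptotics\<close>

lemma ln_div_ln_ln_le:
  assumes m: "m \<ge> 4"
  shows "\<bar>ln (real (m * 2 ^ m)) / ln (ln (real (m * 2 ^ m)))\<bar> \<le> 2 * real m"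
proof -
  let ?n = "real (m * 2 ^ m)"
  have e: "exp 1 \<le> (3::real)"
    by (rule exp_le)
  have "exp (3::real) = exp 1 ^ 3"
    by (simp flip: exp_of_nat_mult)
  also have "\<dots> \<le> 3 ^ 3"
    using e by (intro power_mono) auto
  also have "\<dots> \<le> real 4 * 2 ^ 4"
    by simp
  also have "\<dots> \<le> real m * 2 ^ m"
    using m by (intro mult_mono power_increasing) auto
  finally have "exp 3 \<le> ?n"
    by simp
  then have ln_ge: "3 \<le> ln ?n"
    using m by (subst ln_ge_iff) auto
  then have "1 \<le> ln (ln ?n)"
    using e by (subst ln_ge_iff) auto
  moreover from this have "ln ?n / ln (ln ?n) \<le> ln ?n / 1"
    using ln_ge by (intro divide_left_mono) auto
  ultimately have "\<bar>ln ?n / ln (ln ?n)\<bar> \<le> ln ?n"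
    using ln_ge by (subst abs_of_nonneg) auto
  moreover have "ln ?n = ln (real m) + real m * ln 2"
    using m by (simp add: ln_mult ln_realpow)
  moreover have "ln (real m) \<le> real m - 1"
    using m by (intro ln_le_minus_one) simp
  moreover have "real m * ln 2 \<le> real m * 1"
    using ln_2_less_1 by (intro mult_left_mono) auto
  ultimately show ?thesis by linarith
qed

theorem theorem2:
  shows "\<exists>G :: nat \<Rightarrow> nat pair_pre_digraph.
           (\<forall>i. pair_graph (G i)) \<and>
           strict_mono (\<lambda>i. graph_order (G i)) \<and>
           (\<exists>C. \<forall>i. stretch_width (G i) \<le> C) \<and>
           (\<lambda>i. real (clique_width (G i))) \<in>
             \<Omega>(\<lambda>i. ln (real (graph_order (G i))) / ln (ln (real (graph_order (G i)))))"
\<comment> \<open>The shift by 2 meets the condition \<open>m \<ge> 2\<close> of the clique-width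
  bound.\<close>
proof (intro exI[of _ "\<lambda>i. dyadic_grid (i + 2)"] conjI)
  have order: "graph_order (dyadic_grid m) = m * 2 ^ m" for m
    by (simp add: dyadic_grid_def)
  show "\<forall>i. pair_graph (dyadic_grid (i + 2))"
    using pair_graph_dyadic_grid by blast
  show "strict_mono (\<lambda>i. graph_order (dyadic_grid (i + 2)))"
    unfolding order strict_mono_Suc_iff by simp
  show "\<exists>C. \<forall>i. stretch_width (dyadic_grid (i + 2)) \<le> C"
    using stretch_width_dyadic_grid_le by (intro exI[of _ 26]) simp
  show "(\<lambda>i. real (clique_width (dyadic_grid (i + 2)))) \<in>
      \<Omega>(\<lambda>i. ln (real (graph_order (dyadic_grid (i + 2)))) /
             ln (ln (real (graph_order (dyadic_grid (i + 2))))))"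
  \<comment> \<open>The constant 24 is 2 from the logarithmic estimate times 12 from the
    clique-width bound.\<close>
  proof (rule landau_omega.bigI[of "1 / 24"])
    show "eventually (\<lambda>i. 1 / 24 * norm (ln (real (graph_order (dyadic_grid (i + 2)))) /
        ln (ln (real (graph_order (dyadic_grid (i + 2)))))) \<le>
        norm (real (clique_width (dyadic_grid (i + 2))))) at_top"
    \<comment> \<open>From 2 on, \<open>i + 2 \<ge> 4\<close>, as the logarithmic estimate
      requires.\<close>
    proof (rule eventually_at_top_linorderI[of 2])
      fix i :: nat assume "2 \<le> i"
      then have "\<bar>ln (real ((i + 2) * 2 ^ (i + 2))) / ln (ln (real ((i + 2) * 2 ^ (i + 2))))\<bar>
          \<le> 2 * real (i + 2)"
        by (intro ln_div_ln_ln_le) simp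
      moreover have "real (i + 2) \<le> real (12 * clique_width (dyadic_grid (i + 2)))"
        using clique_width_dyadic_grid_ge[of "i + 2"] by (subst of_nat_le_iff) simp
      ultimately show "1 / 24 * norm (ln (real (graph_order (dyadic_grid (i + 2)))) /
          ln (ln (real (graph_order (dyadic_grid (i + 2)))))) \<le>
          norm (real (clique_width (dyadic_grid (i + 2))))"
        unfolding order real_norm_def of_nat_mult[of 12] by simp
    qed
  qed simp
qed

end
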